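(* Let $P\in\mathbb{Z}[x]$ be a monic polynomial of degree $2$ or $3$ and let $\alpha\in\mathbb{R}$, $\alpha\ge 0$. For all $\epsilon>0$ there exist $n,d_1,d_2\in\mathbb{Z}$, which can be computed explicitly, such that $$P(n)=d_1d_2\quad\text{and}\quad \left|\frac{d_1}{d_2}-\alpha\right|<\epsilon.$$
   Context: The ratio $d_1/d_2$ is understood to be defined, i.e. $d_2\neq 0$. *)

theory Defs
  imports Complex_Main "HOL-Computational_Algebra.Polynomial" "HOL-Library.Nat_Bijection"
begin

text \<open>
  \<open>recursive_fun n f\<close> says that \<open>f\<close> is an \<open>n\<close>-ary total (general) recursive function; arguments
  are passed as a list and only the values of \<open>f\<close> on lists of length \<open>n\<close> are meaningful.
  Minimisation is restricted to regular functions, so partial functions never occur; by Kleene's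
  normal form theorem this yields exactly the total computable functions.
\<close>

inductive recursive_fun :: "nat \<Rightarrow> (nat list \<Rightarrow> nat) \<Rightarrow> bool" where
  zero: "recursive_fun n (\<lambda>xs. 0)"
| succ: "recursive_fun 1 (\<lambda>xs. Suc (xs ! 0))"
| proj: "i < n \<Longrightarrow> recursive_fun n (\<lambda>xs. xs ! i)"
| comp: "recursive_fun (length gs) f \<Longrightarrow> \<forall>g\<in>set gs. recursive_fun n g
    \<Longrightarrow> recursive_fun n (\<lambda>xs. f (map (\<lambda>g. g xs) gs))"
| prec: "recursive_fun n f \<Longrightarrow> recursive_fun (Suc (Suc n)) g
    \<Longrightarrow> recursive_fun (Suc n) (\<lambda>xs. rec_nat (f (tl xs)) (\<lambda>k r. g (k # r # tl xs)) (hd xs))"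
| mini: "recursive_fun (Suc n) f \<Longrightarrow> \<forall>xs. length xs = n \<longrightarrow> (\<exists>k. f (k # xs) = 0)
    \<Longrightarrow> recursive_fun n (\<lambda>xs. LEAST k. f (k # xs) = 0)"

text \<open>
  A polynomial of degree at most 3 together with a nonnegative rational \<open>p / q\<close> and a tolerance
  \<open>1 / m\<close>, as seven natural numbers; integers are coded by the bijection \<^const>\<open>int_encode\<close>.
\<close>

definition input_code :: "int poly \<Rightarrow> nat \<Rightarrow> nat \<Rightarrow> nat \<Rightarrow> nat list" where
  "input_code P p q m =
    [int_encode (coeff P 0), int_encode (coeff P 1), int_encode (coeff P 2),
     int_encode (coeff P 3), p, q, m]"

definition approx_factorization :: "int poly \<Rightarrow> real \<Rightarrow> real \<Rightarrow> int \<Rightarrow> int \<Rightarrow> int \<Rightarrow> bool" where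
  "approx_factorization P \<alpha> \<epsilon> n d1 d2 \<longleftrightarrow>
    poly P n = d1 * d2 \<and> d2 \<noteq> 0 \<and> \<bar>real_of_int d1 / real_of_int d2 - \<alpha>\<bar> < \<epsilon>"

text \<open>
  A real number cannot itself be the input of an algorithm. An algorithm for real \<open>\<alpha>\<close> and \<open>\<epsilon>\<close>
  receives rational data \<open>p / q\<close> and \<open>1 / m\<close> with \<open>\<bar>p / q - \<alpha>\<bar> + 1 / m \<le> \<epsilon>\<close>: an approximation to
  \<open>\<alpha>\<close> and a tolerance for which being within \<open>1 / m\<close> of \<open>p / q\<close> implies being within \<open>\<epsilon>\<close> of \<open>\<alpha>\<close>.
  Such data exist whenever \<open>\<alpha> \<ge> 0\<close> and \<open>\<epsilon> > 0\<close>, and for rational \<open>\<alpha>\<close> one may take \<open>p / q = \<alpha>\<close>.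
\<close>

definition approx_data :: "real \<Rightarrow> real \<Rightarrow> nat \<Rightarrow> nat \<Rightarrow> nat \<Rightarrow> bool" where
  "approx_data \<alpha> \<epsilon> p q m \<longleftrightarrow>
    q > 0 \<and> m > 0 \<and> \<bar>real p / real q - \<alpha>\<bar> + 1 / real m \<le> \<epsilon>"

end

theory Submission
  imports Defs
begin

text \<open>
  Quadratic \<open>P\<close>: the values of \<open>f(x, y) = x\<^sup>2 + b x y + c y\<^sup>2\<close> are norms from \<open>\<int>[\<theta>]\<close> with
  \<open>P(\<theta>) = 0\<close>, and if \<open>A s - B j = -1\<close> then \<open>(A - j \<theta>) (B - s \<theta>')\<close> has the form
  \<open>n - \<theta>\<close>, so \<open>f(A, j) f(B, s) = P(n)\<close>. Translating \<open>(A, B)\<close> by large multiples of \<open>(j, s)\<close> makes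
  the ratio of the factors tend to \<open>(j / s)\<^sup>2\<close>, which can be chosen close to \<open>\<alpha>\<close>.

  Cubic \<open>P\<close>: let \<open>F\<close> be the value at \<open>(u, v)\<close> of the homogenization of \<open>P\<close>. If
  \<open>v\<close> divides \<open>u\<^sup>2 - 1\<close>, then \<open>n = (u - F) / v\<close> is an integer with \<open>n \<equiv> u / v\<close> modulo \<open>F\<close>, hence
  \<open>F\<close> divides \<open>P(n)\<close>. If \<open>v \<rightarrow> \<infinity>\<close> and \<open>u / v \<rightarrow> y\<close>, then \<open>n \<sim> - v\<^sup>2 P(y)\<close> and the ratio
  \<open>F\<^sup>2 / P(n)\<close> tends to \<open>- 1 / P(y)\<close>; since \<open>P\<close> is onto the reals, \<open>y = j / s\<close> can be chosen to bring
  this close to \<open>\<alpha> > 0\<close>. Suitable pairs are \<open>u = 1 + r j\<close>, \<open>v = r s\<close> with \<open>r j \<equiv> -2\<close> modulo \<open>s\<close>.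

  The integers are computed by unbounded search through all triples \<open>(n, d1, d2)\<close>. Minimisation
  is only available for regular functions, so the search must also stop on inputs that do not
  code a monic polynomial; there every triple is accepted.
\<close>

section \<open>Factorizations with prescribed ratio\<close>

lemma quadratic_ratio:
  fixes b c :: int and \<alpha> \<epsilon> :: real
  assumes "\<alpha> > 0" "\<epsilon> > 0"
  shows "\<exists>n d1 d2 :: int. n^2 + b*n + c = d1 * d2 \<and> d2 \<noteq> 0 \<and> \<bar>d1 / d2 - \<alpha>\<bar> < \<epsilon>"
proof -
  have "isCont (\<lambda>x::real. x^2) (sqrt \<alpha>)" by (intro continuous_intros)
  then have "\<forall>\<^sub>F x in at (sqrt \<alpha>). dist (x^2) ((sqrt \<alpha>)^2) < \<epsilon>"
    unfolding isCont_def by (rule tendstoD) fact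
  then obtain \<delta> where "\<delta> > 0" and \<delta>: "\<And>x. x \<noteq> sqrt \<alpha> \<Longrightarrow> dist x (sqrt \<alpha>) < \<delta> \<Longrightarrow> \<bar>x^2 - \<alpha>\<bar> < \<epsilon>"
    using assms by (auto simp: eventually_at dist_real_def)
  \<comment> \<open>The bound from \<open>\<delta>\<close> holds on a punctured neighbourhood only,
    so \<open>y\<close> is taken strictly to the right of \<open>sqrt \<alpha>\<close>.\<close>
  obtain y where "y \<in> \<rat>" and y: "sqrt \<alpha> < y" "y < sqrt \<alpha> + \<delta>"
    using Rats_dense_in_real[of "sqrt \<alpha>" "sqrt \<alpha> + \<delta>"] \<open>\<delta> > 0\<close> by auto
  then obtain j s :: int where s: "s > 0" "coprime j s" "y = j / s"
    by (elim Rats_cases') auto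
  have y2: "\<bar>(j/s)^2 - \<alpha>\<bar> < \<epsilon>"
    using \<delta>[of y] y s by (auto simp: dist_real_def)
  obtain B0 A0 :: int where "B0 * j + A0 * s = 1"
    using bezout_int[of j s] s by (auto simp: coprime_iff_gcd_eq_1)
  then have det: "(- A0) * s - B0 * j = - 1" by simp
  \<comment> \<open>Adding a multiple of \<open>(j, s)\<close> to \<open>(A, B)\<close> leaves
    \<open>A * s - B * j\<close> unchanged, so the Bezout relation survives for every
    \<open>k\<close>.\<close>
  define A where "A k = - A0 + int k * j" for k
  define B where "B k = B0 + int k * s" for k
  define d1 where "d1 k = A k ^ 2 + b * A k * j + c * j^2" for k
  define d2 where "d2 k = B k ^ 2 + b * B k * s + c * s^2" for k
  \<comment> \<open>The part free of \<open>\<theta>\<close> in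
    \<open>(A - j * \<theta>) * (B - s * \<theta>')\<close> after substituting
    \<open>\<theta>' = - b - \<theta>\<close> and \<open>\<theta> * \<theta>' = c\<close>.\<close>
  define n where "n k = A k * B k + c * j * s + A k * s * b" for k
  have det': "B k * j = A k * s + 1" for k
    using det by (simp add: A_def B_def algebra_simps)
  have factored: "n k ^ 2 + b * n k + c = d1 k * d2 k" for k
    using det'[of k] unfolding n_def d1_def d2_def by algebra
  have inv: "(\<lambda>k. z / real k) \<longlonglongrightarrow> 0" for z :: real
    by (rule lim_const_over_n)
  have Alim: "(\<lambda>k. A k / real k) \<longlonglongrightarrow> j"
  proof -
    have "(\<lambda>k. (- real_of_int A0) / real k + j) \<longlonglongrightarrow> 0 + real_of_int j"
      by (intro tendsto_intros inv)
    moreover have "\<forall>\<^sub>F k in sequentially. (- real_of_int A0) / real k + j = A k / real k"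
      using eventually_gt_at_top[of "0::nat"]
      by eventually_elim (simp add: A_def field_simps)
    ultimately show ?thesis by (simp add: filterlim_cong)
  qed
  have Blim: "(\<lambda>k. B k / real k) \<longlonglongrightarrow> s"
  proof -
    have "(\<lambda>k. real_of_int B0 / real k + s) \<longlonglongrightarrow> 0 + real_of_int s"
      by (intro tendsto_intros inv)
    moreover have "\<forall>\<^sub>F k in sequentially. real_of_int B0 / real k + s = B k / real k"
      using eventually_gt_at_top[of "0::nat"]
      by eventually_elim (simp add: B_def field_simps)
    ultimately show ?thesis by (simp add: filterlim_cong)
  qed
  \<comment> \<open>The second argument \<open>z\<close> stays fixed while \<open>X k\<close> grows
    linearly, so only the square of the first argument survives division by
    \<open>k^2\<close>.\<close>
  have form: "(\<lambda>k. (X k ^ 2 + b * X k * z + c * z^2) / real k ^ 2) \<longlonglongrightarrow> l^2"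
    if X: "(\<lambda>k. X k / real k) \<longlonglongrightarrow> l" for X :: "nat \<Rightarrow> int" and z :: int and l :: real
  proof -
    have "(\<lambda>k. (X k / real k)^2 + b * (X k / real k) * (z / real k) + c * (z / real k)^2)
        \<longlonglongrightarrow> l^2 + b * l * 0 + real_of_int c * 0^2"
      by (intro tendsto_intros X inv)
    \<comment> \<open>This holds even for \<open>k = 0\<close>, where both sides are 0 because
      division by zero yields 0.\<close>
    moreover have "(X k / real k)^2 + b * (X k / real k) * (z / real k) + c * (z / real k)^2
        = (X k ^ 2 + b * X k * z + c * z^2) / real k ^ 2" for k
      by (simp add: power_divide power2_eq_square add_divide_distrib)
    ultimately show ?thesis by simp
  qed
  have d1: "(\<lambda>k. d1 k / real k ^ 2) \<longlonglongrightarrow> j^2"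
    using form[OF Alim, of j] by (simp add: d1_def)
  have d2: "(\<lambda>k. d2 k / real k ^ 2) \<longlonglongrightarrow> s^2"
    using form[OF Blim, of s] by (simp add: d2_def)
  have "(\<lambda>k. (d1 k / real k ^ 2) / (d2 k / real k ^ 2)) \<longlonglongrightarrow> j^2 / s^2"
    using s by (intro tendsto_divide d1 d2) auto
  moreover have "\<forall>\<^sub>F k in sequentially. (d1 k / real k ^ 2) / (d2 k / real k ^ 2) = d1 k / d2 k"
    using eventually_gt_at_top[of "0::nat"] by eventually_elim simp
  ultimately have "(\<lambda>k. d1 k / d2 k) \<longlonglongrightarrow> j^2 / s^2"
    by (rule Lim_transform_eventually)
  then have "(\<lambda>k. d1 k / d2 k) \<longlonglongrightarrow> (j/s)^2"
    by (simp add: power_divide)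
  then have "(\<lambda>k. \<bar>d1 k / d2 k - \<alpha>\<bar>) \<longlonglongrightarrow> \<bar>(j/s)^2 - \<alpha>\<bar>"
    by (intro tendsto_intros)
  then have "\<forall>\<^sub>F k in sequentially. \<bar>d1 k / d2 k - \<alpha>\<bar> < \<epsilon>"
    using y2 order_tendstoD(2) by blast
  \<comment> \<open>Closeness of the quotient alone would not exclude \<open>d2 k = 0\<close>, since
    division by zero is total; the positive limit \<open>s^2\<close> does.\<close>
  moreover have "\<forall>\<^sub>F k in sequentially. d2 k / real k ^ 2 > 0"
    using s by (intro order_tendstoD(1)[OF d2]) simp
  ultimately have "\<forall>\<^sub>F k in sequentially. \<bar>d1 k / d2 k - \<alpha>\<bar> < \<epsilon> \<and> d2 k \<noteq> 0"
    by eventually_elim auto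
  then obtain k where "\<bar>d1 k / d2 k - \<alpha>\<bar> < \<epsilon>" "d2 k \<noteq> 0"
    by (auto dest: eventually_happens'[OF sequentially_bot])
  then show ?thesis using factored by blast
qed

section \<open>Cubic polynomials\<close>

lemma cubic_surj:
  fixes a b c y :: real
  shows "\<exists>x. x^3 + a*x^2 + b*x + c = y"
proof -
  \<comment> \<open>A Cauchy-type root bound: on \<open>\<bar>x\<bar> = M\<close> the cubic term
    dominates all others, which fixes the signs at both ends of the interval.\<close>
  define M where "M = 1 + \<bar>a\<bar> + \<bar>b\<bar> + \<bar>c - y\<bar>"
  have M: "M \<ge> 1" by (simp add: M_def)
  have M2: "M \<le> M^2" using mult_left_mono[of 1 M M] M by (simp add: power2_eq_square)
  have bd: "\<bar>a*x^2 + b*x + (c - y)\<bar> \<le> M^3" if "\<bar>x\<bar> = M" for x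
  proof -
    have "\<bar>a*x^2 + b*x + (c - y)\<bar> \<le> \<bar>a*x^2\<bar> + \<bar>b*x\<bar> + \<bar>c - y\<bar>"
      by (intro order_trans[OF abs_triangle_ineq] add_mono order_refl)
    also have "\<dots> = \<bar>a\<bar> * M^2 + \<bar>b\<bar> * M + \<bar>c - y\<bar> * 1"
      using that by (simp add: abs_mult power2_eq_square)
    also have "\<dots> \<le> \<bar>a\<bar> * M^2 + \<bar>b\<bar> * M^2 + \<bar>c - y\<bar> * M^2"
      using M M2 by (intro add_mono mult_left_mono) auto
    also have "\<dots> \<le> M * M^2"
      by (subst (4) M_def) (simp add: algebra_simps)
    finally show ?thesis by (simp add: power3_eq_cube power2_eq_square)
  qed
  have "\<exists>x\<ge>-M. x \<le> M \<and> x^3 + a*x^2 + b*x + c = y"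
  proof (rule IVT')
    show "(-M)^3 + a*(-M)^2 + b*(-M) + c \<le> y" using bd[of "-M"] M by simp
    show "y \<le> M^3 + a*M^2 + b*M + c" using bd[of M] M by simp
    show "-M \<le> M" using M by simp
  qed (intro continuous_intros)
  then show ?thesis by blast
qed

lemma cubic_ratio:
  fixes a b c :: int and \<alpha> \<epsilon> :: real
  assumes "\<alpha> > 0" "\<epsilon> > 0"
  shows "\<exists>n d1 d2 :: int. n^3 + a*n^2 + b*n + c = d1 * d2 \<and> d2 \<noteq> 0 \<and> \<bar>d1 / d2 - \<alpha>\<bar> < \<epsilon>"
proof -
  define P where "P x = x^3 + a*x^2 + b*x + c" for x :: real
  obtain x where x: "P x = - 1 / \<alpha>"
    using cubic_surj[of a b c "- 1 / \<alpha>"] by (auto simp: P_def)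
  have contP: "isCont P z" for z
    unfolding P_def by (intro continuous_intros)
  have "isCont (\<lambda>z. - 1 / P z) x"
    using x assms by (intro continuous_intros contP) auto
  then have lim: "((\<lambda>z. - 1 / P z) \<longlongrightarrow> \<alpha>) (at x)"
    using x by (auto simp: isCont_def)
  \<comment> \<open>Negativity is kept because it later makes \<open>F k\<close> nonzero and the
    limit of \<open>P(n) / v^6\<close> positive.\<close>
  have "\<forall>\<^sub>F z in at x. dist (- 1 / P z) \<alpha> < \<epsilon> \<and> P z < 0"
    using x assms contP[of x, unfolded isCont_def]
    by (intro eventually_conj tendstoD[OF lim] order_tendstoD(2)) auto
  then obtain \<delta> where "\<delta> > 0"
    and \<delta>: "\<And>z. z \<noteq> x \<Longrightarrow> dist z x < \<delta> \<Longrightarrow> \<bar>- 1 / P z - \<alpha>\<bar> < \<epsilon> \<and> P z < 0"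
    by (auto simp: eventually_at dist_real_def)
  obtain y where "y \<in> \<rat>" and y: "x < y" "y < x + \<delta>"
    using Rats_dense_in_real[of x "x + \<delta>"] \<open>\<delta> > 0\<close> by auto
  then obtain j s :: int where s: "s > 0" "coprime j s" "y = j / s"
    by (elim Rats_cases') auto
  have Py: "\<bar>- 1 / P y - \<alpha>\<bar> < \<epsilon>" "P y < 0"
    using \<delta>[of y] y by (auto simp: dist_real_def)
  obtain g h :: int where gh: "g * j + h * s = 1"
    using bezout_int[of j s] s by (auto simp: coprime_iff_gcd_eq_1)
  define r where "r k = - 2 * g + int k * s" for k
  define u where "u k = 1 + r k * j" for k
  define v where "v k = r k * s" for k
  define F where "F k = u k ^ 3 + a * u k ^ 2 * v k + b * u k * v k ^ 2 + c * v k ^ 3" for k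
  \<comment> \<open>The cofactor of \<open>v\<close> in \<open>u^2 - 1\<close>: here
    \<open>u - 1 = r * j\<close>, and \<open>g * j + h * s = 1\<close> gives
    \<open>u + 1 = s * (2 * h + k * j)\<close>.\<close>
  define e where "e k = j * (2 * h + int k * j)" for k
  have u2: "u k ^ 2 = 1 + v k * e k" for k
    using gh unfolding u_def v_def e_def r_def by algebra
  \<comment> \<open>The quotient \<open>(u - F) / v\<close> written out: replacing
    \<open>u^3\<close> by \<open>u * (1 + v * e)\<close> in \<open>F\<close> exhibits
    \<open>F - u\<close> as a multiple of \<open>v\<close>.\<close>
  define n where "n k = - u k * e k - a * u k ^ 2 - b * u k * v k - c * v k ^ 2" for k
  have n: "n k * v k = u k - F k" for k
    using u2[of k] unfolding n_def F_def by algebra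
  have "F k dvd n k ^ 3 + a * n k ^ 2 + b * n k + c" for k
  proof -
    \<comment> \<open>Modulo \<open>F\<close>, \<open>n * v\<close> is congruent to
      \<open>u\<close>, so \<open>v^3 * P(n)\<close> is congruent to the form at
      \<open>(u, v)\<close>, which is \<open>F\<close> itself.\<close>
    have "v k ^ 3 * (n k ^ 3 + a * n k ^ 2 + b * n k + c)
        = F k * (1 - 3 * u k ^ 2 + 3 * u k * F k - F k ^ 2 + a * v k * (F k - 2 * u k) - b * v k ^ 2)"
      using n[of k] unfolding F_def by algebra
    then have "F k dvd v k ^ 3 * (n k ^ 3 + a * n k ^ 2 + b * n k + c)" by simp
    moreover have "coprime (F k) (v k)"
    proof (rule coprimeI)
      fix z assume z: "z dvd F k" "z dvd v k"
      \<comment> \<open>Modulo \<open>v\<close>, \<open>F\<close> is \<open>u^3\<close>, hence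
        \<open>u * F\<close> is \<open>u^4 = (1 + v * e)^2\<close>, which is 1.\<close>
      have "1 = u k * F k - v k * (u k * (a * u k ^ 2 + b * u k * v k + c * v k ^ 2) + e k * (2 + v k * e k))"
        using u2[of k] unfolding F_def by algebra
      with z show "z dvd 1" by (metis dvd_diff dvd_mult dvd_mult2)
    qed
    ultimately show ?thesis
      by (meson coprime_dvd_mult_right_iff coprime_power_right_iff)
  qed
  then obtain d where d: "\<And>k. n k ^ 3 + a * n k ^ 2 + b * n k + c = F k * d k"
    unfolding dvd_def by metis
  have rinf: "filterlim (\<lambda>k. real_of_int (r k)) at_top sequentially"
  proof -
    have "filterlim (\<lambda>k. real_of_int (- 2 * g) + s * real k) at_top sequentially"
      using s by (intro filterlim_tendsto_add_at_top[OF tendsto_const]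
          filterlim_tendsto_pos_mult_at_top[OF tendsto_const] filterlim_real_sequentially) auto
    then show ?thesis by (simp add: r_def mult.commute)
  qed
  have vinf: "filterlim (\<lambda>k. real_of_int (v k)) at_top sequentially"
    using filterlim_tendsto_pos_mult_at_top[OF tendsto_const _ rinf, of s] s
    by (simp add: v_def mult.commute)
  have vpos: "\<forall>\<^sub>F k in sequentially. real_of_int (v k) > 0"
    using vinf unfolding filterlim_at_top_dense by blast
  have iv: "(\<lambda>k. 1 / real_of_int (v k)) \<longlonglongrightarrow> 0"
    by (intro tendsto_divide_0[OF tendsto_const] filterlim_at_top_imp_at_infinity vinf)
  have uv: "(\<lambda>k. u k / v k) \<longlonglongrightarrow> y"
  proof -
    have "(\<lambda>k. y + 1 / v k) \<longlonglongrightarrow> y + 0" by (intro tendsto_intros iv)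
    moreover have "\<forall>\<^sub>F k in sequentially. y + 1 / v k = u k / v k"
      using vpos
    proof eventually_elim
      case (elim k)
      then have "real_of_int (r k) \<noteq> 0" by (auto simp: v_def)
      then show ?case using s by (simp add: u_def v_def field_simps)
    qed
    ultimately show ?thesis by (simp add: filterlim_cong)
  qed
  have Fv: "(\<lambda>k. F k / v k ^ 3) \<longlonglongrightarrow> P y"
  proof -
    have "(\<lambda>k. P (u k / v k)) \<longlonglongrightarrow> P y"
      by (rule isCont_tendsto_compose[OF contP uv])
    moreover have "\<forall>\<^sub>F k in sequentially. P (u k / v k) = F k / v k ^ 3"
      using vpos by eventually_elim
        (simp add: P_def F_def field_simps power3_eq_cube power2_eq_square)
    ultimately show ?thesis by (simp add: filterlim_cong)
  qed
  have nv: "(\<lambda>k. n k / v k ^ 2) \<longlonglongrightarrow> - P y"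
  proof -
    have "(\<lambda>k. (u k / v k) * (1 / v k) * (1 / v k) - F k / v k ^ 3) \<longlonglongrightarrow> y * 0 * 0 - P y"
      by (intro tendsto_intros uv iv Fv)
    moreover have "\<forall>\<^sub>F k in sequentially.
        (u k / v k) * (1 / v k) * (1 / v k) - F k / v k ^ 3 = n k / v k ^ 2"
      using vpos
    proof eventually_elim
      case (elim k)
      have "u k = F k + n k * v k"
        using n[of k] by simp
      then show ?case
        using elim by (simp add: field_simps power3_eq_cube power2_eq_square)
    qed
    ultimately show ?thesis by (simp add: filterlim_cong)
  qed
  have Pn: "(\<lambda>k. real_of_int (F k * d k) / v k ^ 6) \<longlonglongrightarrow> (- P y) ^ 3"
  proof -
    have "(\<lambda>k. (n k / v k ^ 2) ^ 3 + a * (n k / v k ^ 2) ^ 2 * (1 / v k) ^ 2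
        + b * (n k / v k ^ 2) * (1 / v k) ^ 4 + c * (1 / v k) ^ 6)
        \<longlonglongrightarrow> (- P y) ^ 3 + a * (- P y) ^ 2 * 0 ^ 2 + b * (- P y) * 0 ^ 4 + real_of_int c * 0 ^ 6"
      by (intro tendsto_intros nv iv)
    moreover have "\<forall>\<^sub>F k in sequentially.
        (n k / v k ^ 2) ^ 3 + a * (n k / v k ^ 2) ^ 2 * (1 / v k) ^ 2
        + b * (n k / v k ^ 2) * (1 / v k) ^ 4 + c * (1 / v k) ^ 6 = real_of_int (F k * d k) / v k ^ 6"
      using vpos by eventually_elim
        (simp add: d[symmetric] field_simps power_divide flip: power_add power_mult)
    ultimately show ?thesis by (simp add: filterlim_cong)
  qed
  \<comment> \<open>Rewriting \<open>F / d\<close> as \<open>F^2 / (F * d)\<close> avoids a separate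
    asymptotic for the cofactor \<open>d\<close>: the product is \<open>P(n)\<close>, and the powers
    of \<open>v\<close> cancel.\<close>
  have "(\<lambda>k. (F k / v k ^ 3)^2 / (real_of_int (F k * d k) / v k ^ 6)) \<longlonglongrightarrow> (P y)^2 / (- P y) ^ 3"
    using Py by (intro tendsto_intros Fv Pn) auto
  moreover have "(P y)^2 / (- P y) ^ 3 = - 1 / P y"
    using Py by (simp add: field_simps power3_eq_cube power2_eq_square)
  moreover have "\<forall>\<^sub>F k in sequentially.
      (F k / v k ^ 3)^2 / (real_of_int (F k * d k) / v k ^ 6) = F k / d k"
    using vpos order_tendstoD(2)[OF Fv Py(2)]
    by eventually_elim (simp add: field_simps power2_eq_square flip: power_add power_mult)
  ultimately have "(\<lambda>k. F k / d k) \<longlonglongrightarrow> - 1 / P y"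
    by (simp add: filterlim_cong)
  then have "(\<lambda>k. \<bar>F k / d k - \<alpha>\<bar>) \<longlonglongrightarrow> \<bar>- 1 / P y - \<alpha>\<bar>"
    by (intro tendsto_rabs tendsto_diff tendsto_const)
  then have "\<forall>\<^sub>F k in sequentially. \<bar>F k / d k - \<alpha>\<bar> < \<epsilon>"
    using Py(1) order_tendstoD(2) by blast
  moreover have "\<forall>\<^sub>F k in sequentially. real_of_int (F k * d k) / v k ^ 6 > 0"
    using Py(2) by (intro order_tendstoD(1)[OF Pn]) simp
  ultimately have "\<forall>\<^sub>F k in sequentially. \<bar>F k / d k - \<alpha>\<bar> < \<epsilon> \<and> d k \<noteq> 0"
    by eventually_elim auto
  then obtain k where "\<bar>F k / d k - \<alpha>\<bar> < \<epsilon>" "d k \<noteq> 0"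
    by (auto dest: eventually_happens'[OF sequentially_bot])
  then show ?thesis using d by blast
qed

section \<open>Both degrees, and the boundary case of ratio zero\<close>

lemma approx_factorization_pos:
  assumes "lead_coeff P = 1" "degree P = 2 \<or> degree P = 3" "\<alpha> > 0" "\<epsilon> > 0"
  shows "\<exists>n d1 d2. approx_factorization P \<alpha> \<epsilon> n d1 d2"
  using assms(2)
proof
  assume "degree P = 2"
  with assms(1) have "poly P n = n^2 + coeff P 1 * n + coeff P 0" for n
    by (simp add: poly_altdef numeral_2_eq_2)
  with quadratic_ratio[OF assms(3,4)] show ?thesis
    by (simp add: approx_factorization_def)
next
  assume "degree P = 3"
  with assms(1) have "poly P n = n^3 + coeff P 2 * n^2 + coeff P 1 * n + coeff P 0" for n
    by (simp add: poly_altdef numeral_3_eq_3 numeral_2_eq_2)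
  with cubic_ratio[OF assms(3,4)] show ?thesis
    by (simp add: approx_factorization_def)
qed

text \<open>The target is moved to \<open>\<alpha> + \<epsilon>/2 > 0\<close> with tolerance
  \<open>\<epsilon>/2\<close>, which covers \<open>\<alpha> = 0\<close>.\<close>

lemma approx_factorization_exists:
  assumes "lead_coeff P = 1" "degree P = 2 \<or> degree P = 3" "\<alpha> \<ge> 0" "\<epsilon> > 0"
  shows "\<exists>n d1 d2. approx_factorization P \<alpha> \<epsilon> n d1 d2"
proof -
  obtain n d1 d2 where "approx_factorization P (\<alpha> + \<epsilon>/2) (\<epsilon>/2) n d1 d2"
    using approx_factorization_pos[OF assms(1,2), of "\<alpha> + \<epsilon>/2" "\<epsilon>/2"] assms(3,4) by auto
  then have "approx_factorization P \<alpha> \<epsilon> n d1 d2"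
    unfolding approx_factorization_def by linarith
  then show ?thesis by blast
qed

section \<open>Closure properties of recursive functions\<close>

lemma recursive_fun_comp1:
  "recursive_fun 1 f \<Longrightarrow> recursive_fun n g \<Longrightarrow> recursive_fun n (\<lambda>xs. f [g xs])"
  using recursive_fun.comp[of "[g]" f n] by simp

lemma recursive_fun_comp2:
  "recursive_fun 2 f \<Longrightarrow> recursive_fun n g \<Longrightarrow> recursive_fun n h \<Longrightarrow> recursive_fun n (\<lambda>xs. f [g xs, h xs])"
  using recursive_fun.comp[of "[g, h]" f n] by (simp add: numeral_2_eq_2)

lemma recursive_fun_Suc: "recursive_fun n g \<Longrightarrow> recursive_fun n (\<lambda>xs. Suc (g xs))"
  using recursive_fun_comp1[OF recursive_fun.succ] by simp

lemma recursive_fun_const: "recursive_fun n (\<lambda>xs. c)"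
  by (induction c) (auto intro: recursive_fun.zero recursive_fun_Suc)

text \<open>Primitive recursion with one parameter, with recursive terms substituted for both
  arguments, so that each arithmetic operation is obtained at every arity at once.\<close>

lemma recursive_fun_rec_nat:
  assumes "recursive_fun 1 f" "recursive_fun 3 g" "recursive_fun n s" "recursive_fun n t"
  shows "recursive_fun n (\<lambda>xs. rec_nat (f [t xs]) (\<lambda>k r. g [k, r, t xs]) (s xs))"
proof -
  have "recursive_fun 2 (\<lambda>xs. rec_nat (f (tl xs)) (\<lambda>k r. g (k # r # tl xs)) (hd xs))"
    using recursive_fun.prec[of 1 f g] assms(1,2) by (simp add: numeral_3_eq_3 numeral_2_eq_2)
  from recursive_fun_comp2[OF this assms(3,4)] show ?thesis by simp
qed

lemma recursive_fun_add:
  assumes "recursive_fun n s" "recursive_fun n t"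
  shows "recursive_fun n (\<lambda>xs. s xs + t xs)"
proof -
  have "rec_nat b (\<lambda>k r. Suc r) a = a + b" for a b :: nat by (induction a) auto
  then show ?thesis
    using recursive_fun_rec_nat[OF recursive_fun.proj[of 0 1]
        recursive_fun_Suc[OF recursive_fun.proj[of 1 3]] assms] by simp
qed

lemma recursive_fun_mult:
  assumes "recursive_fun n s" "recursive_fun n t"
  shows "recursive_fun n (\<lambda>xs. s xs * t xs)"
proof -
  have "rec_nat 0 (\<lambda>k r. r + b) a = a * b" for a b :: nat by (induction a) auto
  then show ?thesis
    using recursive_fun_rec_nat[OF recursive_fun.zero[of 1]
        recursive_fun_add[OF recursive_fun.proj[of 1 3] recursive_fun.proj[of 2 3]] assms] by simp
qed

lemma recursive_fun_pred:
  assumes "recursive_fun n s"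
  shows "recursive_fun n (\<lambda>xs. s xs - 1)"
proof -
  have "rec_nat 0 (\<lambda>k r. k) a = a - 1" for a :: nat by (cases a) auto
  then show ?thesis
    using recursive_fun_rec_nat[OF recursive_fun.zero[of 1] recursive_fun.proj[of 0 3] assms assms]
    by simp
qed

lemma recursive_fun_diff:
  assumes "recursive_fun n s" "recursive_fun n t"
  shows "recursive_fun n (\<lambda>xs. s xs - t xs)"
proof -
  \<comment> \<open>Recursion runs over the subtrahend, with the minuend as parameter; hence the
    swapped order \<open>assms(2,1)\<close> below.\<close>
  have "rec_nat a (\<lambda>k r. r - Suc 0) b = a - b" for a b :: nat by (induction b) auto
  then show ?thesis
    using recursive_fun_rec_nat[OF recursive_fun.proj[of 0 1]
        recursive_fun_pred[OF recursive_fun.proj[of 1 3]] assms(2,1)] by simp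
qed

lemmas recursive_fun_arith =
  recursive_fun_const recursive_fun_Suc recursive_fun_add recursive_fun_mult recursive_fun_diff
  recursive_fun.proj

text \<open>With truncated subtraction, \<open>a - Suc (2 * h) = 0\<close> means
  \<open>a \<le> Suc (2 * h)\<close>, and the least such \<open>h\<close> is \<open>a div 2\<close>.
  The search is regular because \<open>h = a\<close> always succeeds.\<close>

lemma recursive_fun_div2:
  assumes "recursive_fun n s"
  shows "recursive_fun n (\<lambda>xs. s xs div 2)"
proof -
  have "recursive_fun 2 (\<lambda>xs. xs ! 1 - Suc (2 * (xs ! 0)))"
    by (intro recursive_fun_arith) auto
  then have "recursive_fun 1 (\<lambda>xs. LEAST h. (h # xs) ! 1 - Suc (2 * ((h # xs) ! 0)) = 0)"
  proof (intro recursive_fun.mini allI impI)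
    fix xs :: "nat list"
    show "\<exists>h. (h # xs) ! 1 - Suc (2 * ((h # xs) ! 0)) = 0" by (intro exI[of _ "xs ! 0"]) simp
  qed (simp add: numeral_2_eq_2)
  from recursive_fun_comp1[OF this assms]
  have "recursive_fun n (\<lambda>xs. LEAST h. s xs \<le> Suc (2 * h))" by simp
  moreover have "(LEAST h. a \<le> Suc (2 * h)) = a div 2" for a :: nat
    by (rule Least_equality) auto
  ultimately show ?thesis by simp
qed

section \<open>Decoding pairs through the integer square root\<close>

definition unpair_root :: "nat \<Rightarrow> nat" where
  "unpair_root k = (LEAST w. k < Suc w * Suc w)"

definition unpair_fst :: "nat \<Rightarrow> nat" where
  "unpair_fst k = k - unpair_root k * unpair_root k"

definition unpair_snd :: "nat \<Rightarrow> nat" where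
  "unpair_snd k = unpair_root k - unpair_fst k"

text \<open>The pair \<open>(a, b)\<close> is coded by \<open>(a + b)^2 + a\<close>, which lies
  below \<open>(a + b + 1)^2\<close> and so has integer square root \<open>a + b\<close>. An
  exhaustive search needs surjectivity only.\<close>

lemma unpair_surj: "\<exists>k. unpair_fst k = a \<and> unpair_snd k = b"
proof -
  have "unpair_root ((a + b) * (a + b) + a) = a + b"
    unfolding unpair_root_def
  proof (rule Least_equality)
    fix w assume "(a + b) * (a + b) + a < Suc w * Suc w"
    then have "(a + b) * (a + b) < Suc w * Suc w" by linarith
    then show "a + b \<le> w" by (metis less_Suc_eq_le mult_le_mono not_le)
  qed simp
  then have "unpair_fst ((a + b) * (a + b) + a) = a" "unpair_snd ((a + b) * (a + b) + a) = b"
    by (simp_all add: unpair_fst_def unpair_snd_def)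
  then show ?thesis by blast
qed

lemma recursive_fun_unpair_root:
  assumes "recursive_fun n s"
  shows "recursive_fun n (\<lambda>xs. unpair_root (s xs))"
proof -
  have "recursive_fun 2 (\<lambda>xs. Suc (xs ! 1) - Suc (xs ! 0) * Suc (xs ! 0))"
    by (intro recursive_fun_arith) auto
  then have "recursive_fun 1 (\<lambda>xs. LEAST h. Suc ((h # xs) ! 1) - Suc ((h # xs) ! 0) * Suc ((h # xs) ! 0) = 0)"
  proof (intro recursive_fun.mini allI impI)
    fix xs :: "nat list"
    show "\<exists>h. Suc ((h # xs) ! 1) - Suc ((h # xs) ! 0) * Suc ((h # xs) ! 0) = 0"
      by (intro exI[of _ "xs ! 0"]) simp
  qed (simp add: numeral_2_eq_2)
  from recursive_fun_comp1[OF this assms]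
  have "recursive_fun n (\<lambda>xs. LEAST h. Suc (s xs) - Suc h * Suc h = 0)" by simp
  moreover have "Suc a - Suc h * Suc h = 0 \<longleftrightarrow> a < Suc h * Suc h" for a h
    by (simp only: diff_is_0_eq Suc_le_eq)
  ultimately show ?thesis by (simp only: unpair_root_def)
qed

lemma recursive_fun_unpair:
  assumes "recursive_fun n s"
  shows "recursive_fun n (\<lambda>xs. unpair_fst (s xs))" "recursive_fun n (\<lambda>xs. unpair_snd (s xs))"
  unfolding unpair_snd_def unpair_fst_def
  by (intro recursive_fun_arith recursive_fun_unpair_root assms)+

section \<open>Integer-valued functions and decidable predicates\<close>

definition recursive_int :: "nat \<Rightarrow> (nat list \<Rightarrow> int) \<Rightarrow> bool" where
  "recursive_int n f \<longleftrightarrow>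
    (\<exists>g h. recursive_fun n g \<and> recursive_fun n h \<and> (\<forall>xs. f xs = int (g xs) - int (h xs)))"

lemma recursive_intI:
  "recursive_fun n g \<Longrightarrow> recursive_fun n h \<Longrightarrow> (\<And>xs. f xs = int (g xs) - int (h xs))
    \<Longrightarrow> recursive_int n f"
  unfolding recursive_int_def by blast

lemma recursive_int_of_nat: "recursive_fun n f \<Longrightarrow> recursive_int n (\<lambda>xs. int (f xs))"
  by (rule recursive_intI[OF _ recursive_fun_const[of n 0]]) auto

lemma recursive_int_1: "recursive_int n (\<lambda>xs. 1)"
  using recursive_int_of_nat[OF recursive_fun_const[of n 1]] by simp

lemma recursive_int_add:
  assumes "recursive_int n s" "recursive_int n t"
  shows "recursive_int n (\<lambda>xs. s xs + t xs)"
proof -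
  from assms obtain g h g' h' where
    "recursive_fun n g" "recursive_fun n h" "\<And>xs. s xs = int (g xs) - int (h xs)"
    "recursive_fun n g'" "recursive_fun n h'" "\<And>xs. t xs = int (g' xs) - int (h' xs)"
    unfolding recursive_int_def by metis
  then show ?thesis
    by (intro recursive_intI[of n "\<lambda>xs. g xs + g' xs" "\<lambda>xs. h xs + h' xs"] recursive_fun_arith) auto
qed

lemma recursive_int_diff:
  assumes "recursive_int n s" "recursive_int n t"
  shows "recursive_int n (\<lambda>xs. s xs - t xs)"
proof -
  from assms obtain g h g' h' where
    "recursive_fun n g" "recursive_fun n h" "\<And>xs. s xs = int (g xs) - int (h xs)"
    "recursive_fun n g'" "recursive_fun n h'" "\<And>xs. t xs = int (g' xs) - int (h' xs)"
    unfolding recursive_int_def by metis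
  then show ?thesis
    by (intro recursive_intI[of n "\<lambda>xs. g xs + h' xs" "\<lambda>xs. h xs + g' xs"] recursive_fun_arith) auto
qed

text \<open>Representing integers as differences of naturals, instead of by
  \<open>int_encode\<close>, lets the ring operations act by expanding products, without case
  distinctions on signs.\<close>

lemma recursive_int_mult:
  assumes "recursive_int n s" "recursive_int n t"
  shows "recursive_int n (\<lambda>xs. s xs * t xs)"
proof -
  from assms obtain g h g' h' where
    "recursive_fun n g" "recursive_fun n h" "\<And>xs. s xs = int (g xs) - int (h xs)"
    "recursive_fun n g'" "recursive_fun n h'" "\<And>xs. t xs = int (g' xs) - int (h' xs)"
    unfolding recursive_int_def by metis
  note st = this
  show ?thesis
  proof (rule recursive_intI)
    show "recursive_fun n (\<lambda>xs. g xs * g' xs + h xs * h' xs)"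
      "recursive_fun n (\<lambda>xs. g xs * h' xs + h xs * g' xs)"
      by (intro recursive_fun_arith st)+
    show "s xs * t xs = int (g xs * g' xs + h xs * h' xs) - int (g xs * h' xs + h xs * g' xs)" for xs
      by (simp add: st(3,6) algebra_simps)
  qed
qed

lemma recursive_int_decode:
  assumes "recursive_fun n s"
  shows "recursive_int n (\<lambda>xs. int_decode (s xs))"
proof (rule recursive_intI)
  \<comment> \<open>The parity bit of the code: it switches between the nonnegative branch
    \<open>s div 2\<close> and the negative branch \<open>- Suc (s div 2)\<close>.\<close>
  let ?p = "\<lambda>xs. s xs - 2 * (s xs div 2)"
  show "recursive_fun n (\<lambda>xs. (1 - ?p xs) * (s xs div 2))" "recursive_fun n (\<lambda>xs. ?p xs * Suc (s xs div 2))"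
    by (intro recursive_fun_arith recursive_fun_div2 assms)+
  show "int_decode (s xs) = int ((1 - ?p xs) * (s xs div 2)) - int (?p xs * Suc (s xs div 2))" for xs
    by (cases "even (s xs)") (auto simp: int_decode_def sum_decode_def elim!: oddE)
qed

text \<open>Truth is the value 0, as minimisation looks for zeros; conjunction then becomes addition
  and negation becomes \<open>1 - f\<close>.\<close>

definition recursive_pred :: "nat \<Rightarrow> (nat list \<Rightarrow> bool) \<Rightarrow> bool" where
  "recursive_pred n Q \<longleftrightarrow> (\<exists>f. recursive_fun n f \<and> (\<forall>xs. Q xs \<longleftrightarrow> f xs = 0))"

lemma recursive_predI:
  "recursive_fun n f \<Longrightarrow> (\<And>xs. Q xs \<longleftrightarrow> f xs = 0) \<Longrightarrow> recursive_pred n Q"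
  unfolding recursive_pred_def by blast

lemma recursive_pred_not:
  assumes "recursive_pred n Q"
  shows "recursive_pred n (\<lambda>xs. \<not> Q xs)"
proof -
  from assms obtain f where "recursive_fun n f" "\<And>xs. Q xs \<longleftrightarrow> f xs = 0"
    unfolding recursive_pred_def by blast
  then show ?thesis
    by (intro recursive_predI[of n "\<lambda>xs. 1 - f xs"] recursive_fun_arith) auto
qed

lemma recursive_pred_conj:
  assumes "recursive_pred n Q" "recursive_pred n R"
  shows "recursive_pred n (\<lambda>xs. Q xs \<and> R xs)"
proof -
  from assms obtain f g where "recursive_fun n f" "\<And>xs. Q xs \<longleftrightarrow> f xs = 0"
    "recursive_fun n g" "\<And>xs. R xs \<longleftrightarrow> g xs = 0"
    unfolding recursive_pred_def by metis
  then show ?thesis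
    by (intro recursive_predI[of n "\<lambda>xs. f xs + g xs"] recursive_fun_arith) auto
qed

lemma recursive_pred_disj:
  assumes "recursive_pred n Q" "recursive_pred n R"
  shows "recursive_pred n (\<lambda>xs. Q xs \<or> R xs)"
  using recursive_pred_not[OF recursive_pred_conj[OF assms[THEN recursive_pred_not]]] by simp

lemma recursive_pred_less:
  assumes "recursive_int n s" "recursive_int n t"
  shows "recursive_pred n (\<lambda>xs. s xs < t xs)"
proof -
  obtain g h where "recursive_fun n g" "recursive_fun n h" "\<And>xs. t xs - s xs = int (g xs) - int (h xs)"
    using recursive_int_diff[OF assms(2,1)] unfolding recursive_int_def by metis
  moreover from this(3) have "s xs < t xs \<longleftrightarrow> Suc (h xs) - g xs = 0" for xs
    by (smt (verit) diff_is_0_eq Suc_le_eq of_nat_less_iff)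
  ultimately show ?thesis
    by (intro recursive_predI[of n "\<lambda>xs. Suc (h xs) - g xs"] recursive_fun_arith) auto
qed

lemma recursive_pred_eq:
  assumes "recursive_int n s" "recursive_int n t"
  shows "recursive_pred n (\<lambda>xs. s xs = t xs)"
  using recursive_pred_conj[OF recursive_pred_less[OF assms, THEN recursive_pred_not]
      recursive_pred_less[OF assms(2,1), THEN recursive_pred_not]]
  by (simp add: eq_iff linorder_not_less conj_commute)

lemma recursive_fun_Least:
  assumes "recursive_pred (Suc n) Q" "\<And>xs. length xs = n \<Longrightarrow> \<exists>k. Q (k # xs)"
  shows "recursive_fun n (\<lambda>xs. LEAST k. Q (k # xs))"
proof -
  from assms(1) obtain f where f: "recursive_fun (Suc n) f" "\<And>xs. Q xs \<longleftrightarrow> f xs = 0"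
    unfolding recursive_pred_def by blast
  show ?thesis
    using recursive_fun.mini[OF f(1)] assms(2) by (simp add: f(2))
qed

section \<open>The search\<close>

text \<open>The input is a lookup function rather than a list, so that the same condition applies to
  \<open>xs\<close> and to a list with the search variable put in front.\<close>

definition valid_input :: "(nat \<Rightarrow> nat) \<Rightarrow> bool" where
  "valid_input v \<longleftrightarrow>
    (int_decode (v 3) = 1 \<or> int_decode (v 3) = 0 \<and> int_decode (v 2) = 1) \<and>
    0 < int (v 5) \<and> 0 < int (v 6)"

text \<open>The inequality between squares is \<open>\<bar>d1 / d2 - p / q\<bar> < 1 / m\<close> with denominators cleared.\<close>

definition output_ok :: "(nat \<Rightarrow> nat) \<Rightarrow> int \<Rightarrow> int \<Rightarrow> int \<Rightarrow> bool" where
  "output_ok v n d1 d2 \<longleftrightarrow>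
    int_decode (v 0) + int_decode (v 1) * n + int_decode (v 2) * (n * n)
      + int_decode (v 3) * (n * n * n) = d1 * d2 \<and>
    d2 \<noteq> 0 \<and>
    int (v 6) * (d1 * int (v 5) - int (v 4) * d2)
      * (int (v 6) * (d1 * int (v 5) - int (v 4) * d2))
      < int (v 5) * d2 * (int (v 5) * d2)"

section \<open>Meaning of the search conditions\<close>

lemma monic_poly_code:
  fixes P :: "int poly"
  assumes "lead_coeff P = 1" "degree P = 2 \<or> degree P = 3"
  shows "coeff P 3 = 1 \<or> coeff P 3 = 0 \<and> coeff P 2 = 1"
    and "poly P n = coeff P 0 + coeff P 1 * n + coeff P 2 * (n * n) + coeff P 3 * (n * n * n)"
  using assms by (auto simp: coeff_eq_0 poly_altdef numeral_3_eq_3 numeral_2_eq_2 algebra_simps)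

lemma input_code_nth:
  "input_code P p q m ! 0 = int_encode (coeff P 0)"
  "input_code P p q m ! 1 = int_encode (coeff P 1)"
  "input_code P p q m ! 2 = int_encode (coeff P 2)"
  "input_code P p q m ! 3 = int_encode (coeff P 3)"
  "input_code P p q m ! 4 = p"
  "input_code P p q m ! 5 = q"
  "input_code P p q m ! 6 = m"
  by (simp_all add: input_code_def eval_nat_numeral)

text \<open>The sign of \<open>d2\<close> is unknown, so after multiplication by
  \<open>m * q * d2\<close> absolute values are compared through their squares.\<close>

lemma cleared_denominators:
  fixes d1 d2 :: int
  assumes "d2 \<noteq> 0" "q > 0" "m > 0"
  shows "int m * (d1 * int q - int p * d2) * (int m * (d1 * int q - int p * d2)) < int q * d2 * (int q * d2)
    \<longleftrightarrow> \<bar>d1 / d2 - real p / real q\<bar> < 1 / real m"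
proof -
  let ?l = "int m * (d1 * int q - int p * d2)" and ?r = "int q * d2"
  have "?l * ?l < ?r * ?r \<longleftrightarrow> \<bar>?l\<bar> < \<bar>?r\<bar>"
    using abs_le_square_iff[of ?r ?l] by (simp add: power2_eq_square flip: not_le)
  also have "\<dots> \<longleftrightarrow> \<bar>real_of_int ?l\<bar> < \<bar>real_of_int ?r\<bar>"
    by linarith
  also have "real_of_int ?l = real_of_int ?r * (real m * (d1 / d2 - real p / real q))"
    using assms by (simp add: field_simps)
  also have "\<bar>\<dots>\<bar> < \<bar>real_of_int ?r\<bar> \<longleftrightarrow> real m * \<bar>d1 / d2 - real p / real q\<bar> < 1"
    using assms by (simp add: abs_mult)
  also have "\<dots> \<longleftrightarrow> \<bar>d1 / d2 - real p / real q\<bar> < 1 / real m"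
    using assms by (simp add: field_simps)
  finally show ?thesis .
qed

lemma output_ok_input_code:
  assumes "lead_coeff P = 1" "degree P = 2 \<or> degree P = 3" "q > 0" "m > 0"
  shows "output_ok ((!) (input_code P p q m)) n d1 d2
    \<longleftrightarrow> approx_factorization P (real p / real q) (1 / real m) n d1 d2"
proof (cases "d2 = 0")
  case False
  then show ?thesis
    unfolding output_ok_def approx_factorization_def input_code_nth
    by (simp only: int_encode_inverse monic_poly_code(2)[OF assms(1,2)]
        cleared_denominators[OF False assms(3,4)])
qed (simp add: output_ok_def approx_factorization_def)

text \<open>Regularity of the search concerns every list of length 7, so each valid list must be
  traced back to a polynomial for which a solution is known.\<close>

lemma valid_input_ex_poly:
  assumes "valid_input ((!) xs)" "length xs = 7"
  obtains P p q m where "lead_coeff P = 1" "degree P = 2 \<or> degree P = 3"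
    "xs = input_code P p q m" "q > 0" "m > 0"
proof -
  let ?P = "[:int_decode (xs ! 0), int_decode (xs ! 1), int_decode (xs ! 2), int_decode (xs ! 3):]"
  have "xs = input_code ?P (xs ! 4) (xs ! 5) (xs ! 6)"
    using assms(2) by (auto simp: input_code_def eval_nat_numeral length_Suc_conv)
  \<comment> \<open>A zero cubic coefficient disappears from the polynomial, leaving degree 2 with
    leading coefficient 1.\<close>
  moreover have "lead_coeff ?P = 1" "degree ?P = 2 \<or> degree ?P = 3"
    using assms(1) by (auto simp: valid_input_def)
  moreover have "xs ! 5 > 0" "xs ! 6 > 0"
    using assms(1) by (auto simp: valid_input_def)
  ultimately show thesis
    using that by blast
qed

lemma output_ok_exists:
  assumes "length xs = 7" "valid_input ((!) xs)"
  shows "\<exists>n d1 d2. output_ok ((!) xs) n d1 d2"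
proof -
  obtain P p q m where P: "lead_coeff P = 1" "degree P = 2 \<or> degree P = 3"
    "xs = input_code P p q m" "q > 0" "m > 0"
    using valid_input_ex_poly[OF assms(2,1)] .
  have "\<exists>n d1 d2. approx_factorization P (real p / real q) (1 / real m) n d1 d2"
    using P by (intro approx_factorization_exists) auto
  then show ?thesis
    by (simp only: P(3) output_ok_input_code[OF P(1,2,4,5)])
qed

definition candidate :: "(nat \<Rightarrow> nat) \<Rightarrow> nat \<Rightarrow> bool" where
  "candidate v k \<longleftrightarrow> \<not> valid_input v \<or>
    output_ok v (int_decode (unpair_fst k)) (int_decode (unpair_fst (unpair_snd k)))
      (int_decode (unpair_snd (unpair_snd k)))"

lemma candidate_exists:
  assumes "length xs = 7"
  shows "\<exists>k. candidate ((!) xs) k"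
proof (cases "valid_input ((!) xs)")
  case True
  then obtain n d1 d2 where ok: "output_ok ((!) xs) n d1 d2"
    using output_ok_exists assms by blast
  obtain l where l: "unpair_fst l = int_encode d1" "unpair_snd l = int_encode d2"
    using unpair_surj by blast
  obtain k where k: "unpair_fst k = int_encode n" "unpair_snd k = l"
    using unpair_surj by blast
  show ?thesis
    by (rule exI[of _ k]) (simp add: candidate_def k l ok)
qed (simp add: candidate_def)

text \<open>The arity is 8 because minimisation puts its variable at position 0 and shifts the seven
  inputs by one.\<close>

lemma recursive_pred_candidate: "recursive_pred 8 (\<lambda>ys. candidate (\<lambda>i. ys ! Suc i) (ys ! 0))"
proof -
  have zero: "recursive_int 8 (\<lambda>ys. 0)"
    using recursive_int_of_nat[OF recursive_fun_const[of 8 0]] by simp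
  have "recursive_pred 8 (\<lambda>ys. valid_input (\<lambda>i. ys ! Suc i))"
    unfolding valid_input_def
    by (intro recursive_pred_conj recursive_pred_disj recursive_pred_eq recursive_pred_less
        recursive_int_1 zero recursive_int_decode recursive_int_of_nat recursive_fun.proj) simp_all
  moreover have "recursive_pred 8 (\<lambda>ys. output_ok (\<lambda>i. ys ! Suc i)
      (int_decode (unpair_fst (ys ! 0))) (int_decode (unpair_fst (unpair_snd (ys ! 0))))
      (int_decode (unpair_snd (unpair_snd (ys ! 0)))))"
    unfolding output_ok_def
    by (intro recursive_pred_conj recursive_pred_not recursive_pred_eq recursive_pred_less
        recursive_int_add recursive_int_diff recursive_int_mult zero recursive_int_decode
        recursive_int_of_nat recursive_fun_unpair recursive_fun.proj) simp_all
  ultimately show ?thesis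
    unfolding candidate_def by (intro recursive_pred_disj recursive_pred_not)
qed

theorem theorem1:
  "(\<forall>(P :: int poly) (\<alpha> :: real).
      lead_coeff P = 1 \<and> (degree P = 2 \<or> degree P = 3) \<and> \<alpha> \<ge> 0 \<longrightarrow>
      (\<forall>\<epsilon>>0. \<exists>n d1 d2 :: int. approx_factorization P \<alpha> \<epsilon> n d1 d2))
   \<and>
   (\<exists>N D1 D2. recursive_fun 7 N \<and> recursive_fun 7 D1 \<and> recursive_fun 7 D2 \<and>
      (\<forall>(P :: int poly) (\<alpha> :: real).
         lead_coeff P = 1 \<and> (degree P = 2 \<or> degree P = 3) \<and> \<alpha> \<ge> 0 \<longrightarrow>
         (\<forall>\<epsilon>>0. \<forall>p q m. approx_data \<alpha> \<epsilon> p q m \<longrightarrow>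
            approx_factorization P \<alpha> \<epsilon>
              (int_decode (N (input_code P p q m)))
              (int_decode (D1 (input_code P p q m)))
              (int_decode (D2 (input_code P p q m))))))"
proof (intro conjI)
  define K where "K = (\<lambda>xs. LEAST k. candidate ((!) xs) k)"
  define N where "N xs = unpair_fst (K xs)" for xs
  define D1 where "D1 xs = unpair_fst (unpair_snd (K xs))" for xs
  define D2 where "D2 xs = unpair_snd (unpair_snd (K xs))" for xs
  have "recursive_fun 7 K"
    using recursive_fun_Least[of 7 "\<lambda>ys. candidate (\<lambda>i. ys ! Suc i) (ys ! 0)"]
      recursive_pred_candidate candidate_exists by (simp add: K_def)
  then have "recursive_fun 7 N" "recursive_fun 7 D1" "recursive_fun 7 D2"
    unfolding N_def D1_def D2_def by (simp_all add: recursive_fun_unpair)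
  moreover have "approx_factorization P \<alpha> \<epsilon> (int_decode (N xs)) (int_decode (D1 xs)) (int_decode (D2 xs))"
    if P: "lead_coeff P = 1" "degree P = 2 \<or> degree P = 3"
      and data: "approx_data \<alpha> \<epsilon> p q m" and xs: "xs = input_code P p q m"
    for P \<alpha> \<epsilon> p q m xs
  proof -
    have pos: "q > 0" "m > 0" and close: "\<bar>real p / real q - \<alpha>\<bar> + 1 / real m \<le> \<epsilon>"
      using data by (auto simp: approx_data_def)
    have "valid_input ((!) xs)"
      using monic_poly_code(1)[OF P] pos by (simp add: valid_input_def xs input_code_nth)
    \<comment> \<open>Validity of the input rules out the disjunct that accepts every triple, so the
      minimum found is a genuine solution.\<close>
    moreover have "candidate ((!) xs) (K xs)"
      unfolding K_def by (rule LeastI_ex[OF candidate_exists]) (simp add: xs input_code_def)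
    ultimately have "output_ok ((!) xs) (int_decode (N xs)) (int_decode (D1 xs)) (int_decode (D2 xs))"
      by (simp add: candidate_def N_def D1_def D2_def)
    then have "approx_factorization P (real p / real q) (1 / real m)
        (int_decode (N xs)) (int_decode (D1 xs)) (int_decode (D2 xs))"
      using output_ok_input_code[OF P pos] xs by simp
    then show ?thesis
      using close unfolding approx_factorization_def by linarith
  qed
  ultimately show "\<exists>N D1 D2. recursive_fun 7 N \<and> recursive_fun 7 D1 \<and> recursive_fun 7 D2 \<and>
      (\<forall>(P :: int poly) (\<alpha> :: real).
         lead_coeff P = 1 \<and> (degree P = 2 \<or> degree P = 3) \<and> \<alpha> \<ge> 0 \<longrightarrow>
         (\<forall>\<epsilon>>0. \<forall>p q m. approx_data \<alpha> \<epsilon> p q m \<longrightarrow>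
            approx_factorization P \<alpha> \<epsilon>
              (int_decode (N (input_code P p q m)))
              (int_decode (D1 (input_code P p q m)))
              (int_decode (D2 (input_code P p q m)))))"
    by blast
qed (use approx_factorization_exists in blast)

end
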